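(* Let $\beta>\alpha>0$ and $x,y\in(0,1)$, and put $$U=\frac{\beta x-\alpha y}{\beta-\alpha},\qquad V=\frac{\beta x-\alpha(1-y)}{\beta-\alpha}.$$ Assume $U,V\in(0,1)$. Then $$\max\{\sin^{\beta-\alpha}(\pi U),\sin^{\beta-\alpha}(\pi V)\}=\begin{cases}\sin^{\beta-\alpha}(\pi U),&\text{if }(1-2y)(2x-1)\leq0,\\ \sin^{\beta-\alpha}(\pi V),&\text{if }(1-2y)(2x-1)\geq0.\end{cases}$$ Moreover, equality $\sin^{\beta-\alpha}(\pi U)=\sin^{\beta-\alpha}(\pi V)$ occurs when $y=\frac12$ or $x=\frac12$.
   Context: Here $\sin^{c}(t)$ denotes $(\sin t)^c$. *)

theory Defs
  imports Complex_Main
begin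

end

(* sin (pi * t) decreases with the distance of t from 1/2, and
   (U - 1/2)^2 - (V - 1/2)^2 = (U - V) * (U + V - 1) is a nonnegative multiple of
   (1 - 2 * y) * (2 * x - 1). *)
theory Submission
  imports Defs
begin

text \<open>On the unit interval the sine of \<open>pi * t\<close> is governed by the distance of
  \<open>t\<close> from 1/2, so comparing the values at U and V means comparing two squared
  distances, whose difference factors. In terms of x and y that difference is a nonnegative constant
  times \<open>(1 - 2 * y) * (2 * x - 1)\<close>, whose sign therefore decides which sine is larger.
  The sines are nonnegative and \<beta> - \<alpha> > 0, so raising to this power keeps the
  order.\<close>

lemma sin_pi_le_sin_pi:
  fixes u v :: real
  assumes "v \<in> {0..1}" and "(u - v) * (u + v - 1) \<le> 0"
  shows "sin (pi * v) \<le> sin (pi * u)"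
proof -
  \<comment> \<open>A shift by a quarter period turns sine into cosine, and evenness of cosine
    permits the absolute value.\<close>
  have sin_eq_cos: "sin (pi * t) = cos (pi * \<bar>t - 1/2\<bar>)" for t :: real
  proof -
    have "sin (pi * t) = cos (pi * (t - 1/2))"
      by (simp add: right_diff_distrib cos_diff)
    also have "\<dots> = cos (pi * \<bar>t - 1/2\<bar>)"
      by (metis abs_mult abs_of_nonneg cos_abs_real pi_ge_zero)
    finally show ?thesis .
  qed
  \<comment> \<open>The assumed product is exactly the left square minus the right one.\<close>
  have "(u - 1/2)\<^sup>2 \<le> (v - 1/2)\<^sup>2"
    using assms(2) by (simp add: power2_eq_square algebra_simps)
  then have "\<bar>u - 1/2\<bar> \<le> \<bar>v - 1/2\<bar>"
    by (simp add: abs_le_square_iff)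
  \<comment> \<open>Keeps both cosine arguments in [0, pi], where cosine decreases.\<close>
  moreover have "\<bar>v - 1/2\<bar> \<le> 1"
    using assms(1) by auto
  ultimately show ?thesis
    unfolding sin_eq_cos by (intro cos_monotone_0_pi_le) auto
qed

theorem corollary4p4:
  fixes \<alpha> \<beta> x y U V :: real
  assumes "\<beta> > \<alpha>" and "\<alpha> > 0"
    and "x \<in> {0<..<1}" and "y \<in> {0<..<1}"
    and "U = (\<beta> * x - \<alpha> * y) / (\<beta> - \<alpha>)"
    and "V = (\<beta> * x - \<alpha> * (1 - y)) / (\<beta> - \<alpha>)"
    and "U \<in> {0<..<1}" and "V \<in> {0<..<1}"
  shows "((1 - 2 * y) * (2 * x - 1) \<le> 0 \<longrightarrow>
            max (sin (pi * U) powr (\<beta> - \<alpha>)) (sin (pi * V) powr (\<beta> - \<alpha>))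
              = sin (pi * U) powr (\<beta> - \<alpha>))
       \<and> ((1 - 2 * y) * (2 * x - 1) \<ge> 0 \<longrightarrow>
            max (sin (pi * U) powr (\<beta> - \<alpha>)) (sin (pi * V) powr (\<beta> - \<alpha>))
              = sin (pi * V) powr (\<beta> - \<alpha>))
       \<and> (y = 1 / 2 \<or> x = 1 / 2 \<longrightarrow>
            sin (pi * U) powr (\<beta> - \<alpha>) = sin (pi * V) powr (\<beta> - \<alpha>))"
proof -
  \<comment> \<open>Product of the factors \<alpha> / (\<beta> - \<alpha>) from \<open>U - V\<close>
    and \<beta> / (\<beta> - \<alpha>) from \<open>U + V - 1\<close>.\<close>
  define c where "c = \<alpha> * \<beta> / (\<beta> - \<alpha>)\<^sup>2"
  have "c \<ge> 0"
    using assms(1,2) by (simp add: c_def)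
  have U_eq: "U * (\<beta> - \<alpha>) = \<beta> * x - \<alpha> * y"
    and V_eq: "V * (\<beta> - \<alpha>) = \<beta> * x - \<alpha> * (1 - y)"
    using assms(1,5,6) by simp_all
  have "(U - V) * (\<beta> - \<alpha>) = \<alpha> * (1 - 2 * y)"
    using U_eq V_eq by (simp add: algebra_simps)
  then have "U - V = \<alpha> * (1 - 2 * y) / (\<beta> - \<alpha>)"
    using assms(1) by (simp add: eq_divide_eq)
  moreover have "(U + V - 1) * (\<beta> - \<alpha>) = \<beta> * (2 * x - 1)"
    using U_eq V_eq by (simp add: algebra_simps)
  then have "U + V - 1 = \<beta> * (2 * x - 1) / (\<beta> - \<alpha>)"
    using assms(1) by (simp add: eq_divide_eq)
  ultimately have prod: "(U - V) * (U + V - 1) = c * ((1 - 2 * y) * (2 * x - 1))"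
    by (simp add: c_def power2_eq_square)
  have V_le: "sin (pi * V) powr (\<beta> - \<alpha>) \<le> sin (pi * U) powr (\<beta> - \<alpha>)"
    if "(1 - 2 * y) * (2 * x - 1) \<le> 0"
  proof (rule powr_mono2)
    show "sin (pi * V) \<le> sin (pi * U)"
      using assms(8) mult_nonneg_nonpos [OF \<open>c \<ge> 0\<close> that] prod
      by (intro sin_pi_le_sin_pi) auto
    show "0 \<le> sin (pi * V)"
      using assms(8) by (intro sin_ge_zero) auto
  qed (use assms(1) in simp)
  have U_le: "sin (pi * U) powr (\<beta> - \<alpha>) \<le> sin (pi * V) powr (\<beta> - \<alpha>)"
    if "(1 - 2 * y) * (2 * x - 1) \<ge> 0"
  proof (rule powr_mono2)
    \<comment> \<open>Swapping U and V flips the sign of the product, so the same lemma gives the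
      reverse inequality.\<close>
    have "(V - U) * (V + U - 1) = - ((U - V) * (U + V - 1))"
      by (simp add: algebra_simps)
    then show "sin (pi * U) \<le> sin (pi * V)"
      using assms(7) mult_nonneg_nonneg [OF \<open>c \<ge> 0\<close> that] prod
      by (intro sin_pi_le_sin_pi) auto
    show "0 \<le> sin (pi * U)"
      using assms(7) by (intro sin_ge_zero) auto
  qed (use assms(1) in simp)
  have "sin (pi * U) powr (\<beta> - \<alpha>) = sin (pi * V) powr (\<beta> - \<alpha>)" if "y = 1/2 \<or> x = 1/2"
  proof -
    \<comment> \<open>Zero meets both sign conditions, so both inequalities hold.\<close>
    have "(1 - 2 * y) * (2 * x - 1) = 0"
      using that by auto
    then show ?thesis
      by (intro antisym U_le V_le) (simp_all only: order_refl)
  qed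
  then show ?thesis
    using U_le V_le by (auto simp: max_def intro: antisym)
qed

end
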